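(* Let $\rho\ge 1$ and let $\mathsf{A}_\rho$ be a $\rho$-competitive algorithm for the (non-)preemptive semi-online machine minimization problem. Then Algorithm Double (defined in the context, using $\mathsf{A}_\rho$ as subroutine) is $4\rho$-competitive for the (non-)preemptive online machine minimization problem.
   Context: An instance is a finite set of jobs $J$; each job $j$ has processing time $p_j\in\mathbb{N}$, release date $r_j\in\mathbb{N}$, deadline $d_j\in\mathbb{N}$. A feasible schedule processes each job for $p_j$ time units within $[r_j,d_j)$, with each machine processing at most one job at a time and no job on two machines simultaneously; in the preemptive variant preemption and migration are allowed, in the non-preemptive variant each job runs uninterrupted on one machine once started. In the online problem a job becomes known only at its release date, decisions are irrevocable, and the cost is the total number of machines opened. In the semi-online problem, the algorithm is additionally given in advance the optimal number $m$ of machines; $\mathsf{A}_\rho(m')$ denotes the semi-online algorithm run with given value $m'$. An (semi-)online algorithm is $c$-competitive if for every instance admitting a feasible schedule on $m$ machines it produces a feasible schedule on at most $c\cdot m$ machines (for semi-online: when given the value $m$). For a time $t$, let $m(t)$ be the minimum number of machines needed to feasibly schedule all jobs released up to time $t$. Algorithm Double: let $t_0=\min_{j\in J}r_j$ and for $i=1,2,\dots$ let $t_i=\min\{t\mid m(t)>2m(t_{i-1})\}$. At each time $t_i$, $i=0,1,\dots$, open $2\rho m(t_i)$ additional machines; all jobs with $r_j\in[t_{i},t_{i+1})$ are scheduled by $\mathsf{A}_\rho(2m(t_{i}))$ on the machines opened at time $t_{i}$. *)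

theory Defs
  imports "HOL-Analysis.Analysis"
begin

text \<open>
  Time is continuous (type real), while the data of a job are natural numbers.  The identifier
  allows an instance (a finite set of jobs) to contain several jobs with the same data.
\<close>

datatype job = Job (job_id: nat) (proc_time: nat) (release: nat) (deadline: nat)

datatype variant = Preemptive | Nonpreemptive

text \<open>
  In a schedule S, the value S i t is the job that machine i processes at time t, if any.  That a
  machine processes at most one job at a time is thus built into the type.
\<close>

type_synonym schedule = "nat \<Rightarrow> real \<Rightarrow> job option"

definition preemptive_feasible :: "job set \<Rightarrow> nat \<Rightarrow> schedule \<Rightarrow> bool" where
  "preemptive_feasible J m S \<longleftrightarrow>
     (\<forall>i t j. S i t = Some j \<longrightarrow>
        i < m \<and> j \<in> J \<and> real (release j) \<le> t \<and> t < real (deadline j)) \<and>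
     (\<forall>i i' t j. S i t = Some j \<and> S i' t = Some j \<longrightarrow> i = i') \<and>
     (\<forall>j\<in>J. (\<forall>i<m. {t. S i t = Some j} \<in> sets lebesgue) \<and>
        (\<Sum>i<m. measure lebesgue {t. S i t = Some j}) = real (proc_time j))"

definition uninterrupted :: "job set \<Rightarrow> schedule \<Rightarrow> bool" where
  "uninterrupted J S \<longleftrightarrow>
     (\<forall>j\<in>J. \<exists>i s. \<forall>i' t.
        S i' t = Some j \<longleftrightarrow> i' = i \<and> s \<le> t \<and> t < s + real (proc_time j))"

definition feasible :: "variant \<Rightarrow> job set \<Rightarrow> nat \<Rightarrow> schedule \<Rightarrow> bool" where
  "feasible v J m S \<longleftrightarrow>
     preemptive_feasible J m S \<and> (v = Nonpreemptive \<longrightarrow> uninterrupted J S)"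

definition schedulable :: "variant \<Rightarrow> job set \<Rightarrow> nat \<Rightarrow> bool" where
  "schedulable v J m \<longleftrightarrow> (\<exists>S. feasible v J m S)"

definition min_machines :: "variant \<Rightarrow> job set \<Rightarrow> nat" where
  "min_machines v J = (LEAST m. schedulable v J m)"

definition released :: "job set \<Rightarrow> real \<Rightarrow> job set" where
  "released J t = {j \<in> J. real (release j) \<le> t}"

definition m_at :: "variant \<Rightarrow> job set \<Rightarrow> real \<Rightarrow> nat" where
  "m_at v J t = min_machines v (released J t)"

text \<open>
  A run of an algorithm consists of the number of machines opened up to each time and of the
  schedule produced.  Machines are numbered in the order in which they are opened.
\<close>

datatype run = Run (opened: "real \<Rightarrow> nat") (sched: schedule)

type_synonym algorithm = "job set \<Rightarrow> run"

text \<open>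
  A deterministic algorithm is online if what it has done at time t depends only on the jobs
  released up to t, opened machines are never closed again, and only opened machines are used.
\<close>

definition online_algorithm :: "algorithm \<Rightarrow> bool" where
  "online_algorithm A \<longleftrightarrow>
     (\<forall>J J' t. finite J \<and> finite J' \<and> released J t = released J' t \<longrightarrow>
        opened (A J) t = opened (A J') t \<and> (\<forall>i. sched (A J) i t = sched (A J') i t)) \<and>
     (\<forall>J. finite J \<longrightarrow> mono (opened (A J)) \<and>
        (\<forall>i t j. sched (A J) i t = Some j \<longrightarrow> i < opened (A J) t))"

definition semi_online_algorithm :: "(nat \<Rightarrow> algorithm) \<Rightarrow> bool" where
  "semi_online_algorithm A \<longleftrightarrow> (\<forall>m. online_algorithm (A m))"

definition solves_within :: "variant \<Rightarrow> job set \<Rightarrow> real \<Rightarrow> run \<Rightarrow> bool" where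
  "solves_within v J b R \<longleftrightarrow>
     (\<exists>M. real M \<le> b \<and> (\<forall>t. opened R t \<le> M) \<and> feasible v J M (sched R))"

definition competitive_online :: "variant \<Rightarrow> real \<Rightarrow> algorithm \<Rightarrow> bool" where
  "competitive_online v c A \<longleftrightarrow> online_algorithm A \<and>
     (\<forall>J m. finite J \<and> schedulable v J m \<longrightarrow> solves_within v J (c * real m) (A J))"

definition competitive_semi_online :: "variant \<Rightarrow> real \<Rightarrow> (nat \<Rightarrow> algorithm) \<Rightarrow> bool" where
  "competitive_semi_online v c A \<longleftrightarrow> semi_online_algorithm A \<and>
     (\<forall>J m. finite J \<and> schedulable v J m \<longrightarrow> solves_within v J (c * real m) (A m J))"

text \<open>
  The opening times of Algorithm Double; the value None means that there is no i-th opening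
  time, in which case the preceding phase (if any) lasts forever.
\<close>

fun double_time :: "variant \<Rightarrow> job set \<Rightarrow> nat \<Rightarrow> real option" where
  "double_time v J 0 =
     (if J = {} then None else Some (Min ((\<lambda>j. real (release j)) ` J)))"
| "double_time v J (Suc i) =
     (case double_time v J i of
        None \<Rightarrow> None
      | Some s \<Rightarrow>
          (if \<exists>t. m_at v J t > 2 * m_at v J s
           then Some (LEAST t. m_at v J t > 2 * m_at v J s) else None))"

definition phase_jobs :: "variant \<Rightarrow> job set \<Rightarrow> nat \<Rightarrow> job set" where
  "phase_jobs v J i =
     {j \<in> J. (\<exists>s. double_time v J i = Some s \<and> s \<le> real (release j)) \<and>
        (\<forall>s. double_time v J (Suc i) = Some s \<longrightarrow> real (release j) < s)}"

definition phase_guess :: "variant \<Rightarrow> job set \<Rightarrow> nat \<Rightarrow> nat" where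
  "phase_guess v J i =
     (case double_time v J i of None \<Rightarrow> 0 | Some s \<Rightarrow> 2 * m_at v J s)"

text \<open>
  The number of machines opened in phase i is rounded down to an integer; an algorithm using at
  most \<rho> times the guess many machines never needs more.
\<close>

definition phase_machines :: "variant \<Rightarrow> real \<Rightarrow> job set \<Rightarrow> nat \<Rightarrow> nat" where
  "phase_machines v \<rho> J i = nat \<lfloor>\<rho> * real (phase_guess v J i)\<rfloor>"

definition double_opened :: "variant \<Rightarrow> real \<Rightarrow> job set \<Rightarrow> real \<Rightarrow> nat" where
  "double_opened v \<rho> J t =
     (\<Sum>i | \<exists>s. double_time v J i = Some s \<and> s \<le> t. phase_machines v \<rho> J i)"

definition phase_offset :: "variant \<Rightarrow> real \<Rightarrow> job set \<Rightarrow> nat \<Rightarrow> nat" where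
  "phase_offset v \<rho> J i = (\<Sum>k<i. phase_machines v \<rho> J k)"

text \<open>
  The machines opened in phase i are those with numbers from phase_offset i (inclusive) to
  phase_offset (i + 1) (exclusive).
\<close>

definition machine_phase :: "variant \<Rightarrow> real \<Rightarrow> job set \<Rightarrow> nat \<Rightarrow> nat" where
  "machine_phase v \<rho> J x = (LEAST i. x < phase_offset v \<rho> J (Suc i))"

definition double_sched ::
    "variant \<Rightarrow> real \<Rightarrow> (nat \<Rightarrow> algorithm) \<Rightarrow> job set \<Rightarrow> schedule" where
  "double_sched v \<rho> A J x t =
     (if x < double_opened v \<rho> J t
      then let i = machine_phase v \<rho> J x
           in sched (A (phase_guess v J i) (phase_jobs v J i)) (x - phase_offset v \<rho> J i) t
      else None)"

definition double :: "variant \<Rightarrow> real \<Rightarrow> (nat \<Rightarrow> algorithm) \<Rightarrow> algorithm" where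
  "double v \<rho> A J = Run (double_opened v \<rho> J) (double_sched v \<rho> A J)"

end

theory Submission
  imports Defs
begin

text \<open>
  Since \<open>m(t\<^sub>i\<^sub>+\<^sub>1) > 2 m(t\<^sub>i)\<close>, the sum of the \<open>m(t\<^sub>i)\<close> is at most twice the last one, so at most
  \<open>4 \<rho> m\<close> machines are opened.  The jobs of phase \<open>i\<close> are all released at a time \<open>t\<close> with
  \<open>m(t) \<le> 2 m(t\<^sub>i)\<close>, so the subroutine schedules them on the machines of its phase, and it uses
  these machines only from \<open>t\<^sub>i\<close> on, when they are already open.
\<close>

section \<open>Feasible schedules\<close>

lemma feasibleD:
  assumes "feasible v J m S"
  shows "S i t = Some j \<Longrightarrow> i < m"
    and "S i t = Some j \<Longrightarrow> j \<in> J"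
    and "S i t = Some j \<Longrightarrow> real (release j) \<le> t"
    and "S i t = Some j \<Longrightarrow> t < real (deadline j)"
    and "S i t = Some j \<Longrightarrow> S i' t = Some j \<Longrightarrow> i = i'"
    and "j \<in> J \<Longrightarrow> i < m \<Longrightarrow> {t. S i t = Some j} \<in> sets lebesgue"
    and "j \<in> J \<Longrightarrow> (\<Sum>i<m. measure lebesgue {t. S i t = Some j}) = real (proc_time j)"
proof -
  note feas = assms[unfolded feasible_def preemptive_feasible_def, THEN conjunct1]
  show "S i t = Some j \<Longrightarrow> i < m" "S i t = Some j \<Longrightarrow> j \<in> J"
    "S i t = Some j \<Longrightarrow> real (release j) \<le> t" "S i t = Some j \<Longrightarrow> t < real (deadline j)"
    using feas[THEN conjunct1] by blast+
  show "S i t = Some j \<Longrightarrow> S i' t = Some j \<Longrightarrow> i = i'"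
    using feas[THEN conjunct2, THEN conjunct1] by blast
  show "j \<in> J \<Longrightarrow> i < m \<Longrightarrow> {t. S i t = Some j} \<in> sets lebesgue"
    "j \<in> J \<Longrightarrow> (\<Sum>i<m. measure lebesgue {t. S i t = Some j}) = real (proc_time j)"
    using feas[THEN conjunct2, THEN conjunct2] by simp_all
qed

text \<open>Machines from \<open>m\<close> on are idle, so their sets of busy times are empty:
  measurable and of measure 0. This lets a schedule on fewer machines fill a larger block.\<close>

lemma feasible_mono_machines:
  assumes "feasible v J m S" "m \<le> m'"
  shows "feasible v J m' S"
proof -
  have less: "i < m" if "S i t = Some j" for i t j
    using feasibleD(1)[OF assms(1) that] .
  have empty: "{t. S i t = Some j} = {}" if "\<not> i < m" for i j
    using less that by blast
  have "{t. S i t = Some j} \<in> sets lebesgue" if "j \<in> J" for i j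
  proof (cases "i < m")
    case True
    then show ?thesis
      using feasibleD(6)[OF assms(1) that] by blast
  qed (simp add: empty)
  moreover have "(\<Sum>i<m'. measure lebesgue {t. S i t = Some j}) =
      (\<Sum>i<m. measure lebesgue {t. S i t = Some j})" for j
    by (rule sum.mono_neutral_right) (use assms(2) in \<open>auto simp: empty\<close>)
  moreover have "i < m'" if "S i t = Some j" for i t j
    using less[OF that] assms(2) by simp
  ultimately show ?thesis
    using assms(1) unfolding feasible_def preemptive_feasible_def by simp
qed

text \<open>Erasing the jobs outside \<open>J'\<close> from a schedule leaves the processing of
  every other job untouched.\<close>

lemma schedulable_subset:
  assumes "schedulable v J m" "J' \<subseteq> J" "m \<le> m'"
  shows "schedulable v J' m'"
proof -
  obtain S where S: "feasible v J m S"
    using assms(1) unfolding schedulable_def by blast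
  define S' where
    "S' = (\<lambda>i t. if \<exists>j\<in>J'. S i t = Some j then S i t else None)"
  have S'_iff: "S' i t = Some j \<longleftrightarrow> S i t = Some j \<and> j \<in> J'" for i t j
    by (auto simp: S'_def)
  have "preemptive_feasible J m S"
    using S by (simp add: feasible_def)
  then have "preemptive_feasible J' m S'"
    using assms(2) unfolding preemptive_feasible_def S'_iff
    by (simp add: subset_iff) blast
  moreover have "uninterrupted J' S'" if "uninterrupted J S"
    using that assms(2) unfolding uninterrupted_def S'_iff
    by (simp add: subset_iff)
  ultimately have "feasible v J' m S'"
    using S by (simp add: feasible_def)
  then show ?thesis
    using feasible_mono_machines[OF _ assms(3)] unfolding schedulable_def by blast
qed

text \<open>Schedules of disjoint job sets are placed side by side: block \<open>i\<close> consists
  of \<open>w i\<close> machines starting at number \<open>off i\<close>. The result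
  \<open>S\<close> is described only by what it processes, so that it can later be instantiated with
  \<open>double_sched\<close>.\<close>

lemma feasible_UN:
  fixes w :: "nat \<Rightarrow> nat"
  defines "off \<equiv> \<lambda>i. \<Sum>k<i. w k"
  assumes feas: "\<And>i. i < N \<Longrightarrow> feasible v (P i) (w i) (T i)"
    and disj: "\<And>i k j. \<lbrakk>j \<in> P i; j \<in> P k\<rbrakk> \<Longrightarrow> i = k"
    and S: "\<And>x t j. S x t = Some j \<longleftrightarrow> (\<exists>i<N. \<exists>y. x = off i + y \<and> T i y t = Some j)"
  shows "feasible v (\<Union>i<N. P i) (off N) S"
proof -
  have TD: "y < w i" "j \<in> P i" "real (release j) \<le> t" "t < real (deadline j)"
    if "T i y t = Some j" "i < N" for i y t j
    using feasibleD(1-4)[OF feas[OF that(2)] that(1)] .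
  have T_unique: "y = y'" if "T i y t = Some j" "T i y' t = Some j" "i < N" for i y y' t j
    using feasibleD(5)[OF feas[OF that(3)] that(1,2)] .
  have off_le: "off i + w i \<le> off N" if "i < N" for i
  proof -
    have "off i + w i = off (Suc i)" by (simp add: off_def)
    also have "\<dots> \<le> off N"
      unfolding off_def by (rule sum_mono2) (use that in auto)
    finally show ?thesis .
  qed
  \<comment> \<open>Each block processes only jobs of its own \<open>P i\<close>, so by disjointness
    a job of \<open>P i\<close> occurs in block \<open>i\<close> alone. Every condition on
    \<open>S\<close> then reduces to the one on \<open>T i\<close>.\<close>
  have S_job: "S x t = Some j \<longleftrightarrow> (\<exists>y. x = off i + y \<and> T i y t = Some j)"
    if "i < N" "j \<in> P i" for i x t j
    unfolding S using that TD(2) disj by metis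
  have "x < off N \<and> j \<in> (\<Union>i<N. P i) \<and> real (release j) \<le> t \<and> t < real (deadline j)"
    if Sj: "S x t = Some j" for x t j
  proof -
    obtain i y where iy: "i < N" "x = off i + y" "T i y t = Some j"
      using Sj unfolding S by blast
    show ?thesis
      using TD[OF iy(3,1)] off_le[OF iy(1)] iy by auto
  qed
  moreover have "\<forall>x x' t j. S x t = Some j \<and> S x' t = Some j \<longrightarrow> x = x'"
  proof (intro allI impI)
    fix x x' t j assume Sj: "S x t = Some j \<and> S x' t = Some j"
    then obtain i y where iy: "i < N" "x = off i + y" "T i y t = Some j"
      unfolding S by blast
    then obtain y' where "x' = off i + y'" "T i y' t = Some j"
      using Sj S_job TD(2) by metis
    then show "x = x'"
      using T_unique iy by blast
  qed
  moreover have "(\<forall>x<off N. {t. S x t = Some j} \<in> sets lebesgue) \<and>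
      (\<Sum>x<off N. measure lebesgue {t. S x t = Some j}) = real (proc_time j)"
    if j: "j \<in> (\<Union>i<N. P i)" for j
  proof -
    obtain i where i: "i < N" "j \<in> P i" using j by blast
    have shifted: "{t. S (off i + y) t = Some j} = {t. T i y t = Some j}" for y
      using S_job[OF i] by auto
    have outside: "{t. S x t = Some j} = {}" if "x \<notin> {off i..<off i + w i}" for x
      using S_job[OF i] TD(1)[OF _ i(1)] that by fastforce
    have meas: "{t. T i y t = Some j} \<in> sets lebesgue" if "y < w i" for y
      using feasibleD(6)[OF feas[OF i(1)] i(2) that] .
    have "{t. S x t = Some j} \<in> sets lebesgue" for x
    proof (cases "x \<in> {off i..<off i + w i}")
      case True
      then show ?thesis using meas[of "x - off i"] shifted[of "x - off i"] by auto
    next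
      case False
      then show ?thesis by (simp add: outside)
    qed
    moreover have "(\<Sum>x<off N. measure lebesgue {t. S x t = Some j}) =
        (\<Sum>x\<in>{off i..<off i + w i}. measure lebesgue {t. S x t = Some j})"
      by (rule sum.mono_neutral_right) (use off_le[OF i(1)] in \<open>auto simp: outside\<close>)
    moreover have "\<dots> = (\<Sum>y<w i. measure lebesgue {t. T i y t = Some j})"
      by (rule sum.reindex_bij_witness[of _ "\<lambda>y. off i + y" "\<lambda>x. x - off i"])
        (auto simp flip: shifted)
    moreover have "\<dots> = real (proc_time j)"
      using feasibleD(7)[OF feas[OF i(1)] i(2)] .
    ultimately show ?thesis by simp
  qed
  moreover have "uninterrupted (\<Union>i<N. P i) S" if v: "v = Nonpreemptive"
    unfolding uninterrupted_def
  proof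
    fix j assume "j \<in> (\<Union>i<N. P i)"
    then obtain i where i: "i < N" "j \<in> P i" by blast
    then obtain y s where
      "\<forall>y' t. T i y' t = Some j \<longleftrightarrow> y' = y \<and> s \<le> t \<and> t < s + real (proc_time j)"
      using feas[OF i(1)] v unfolding feasible_def uninterrupted_def by blast
    then show "\<exists>x s. \<forall>x' t. S x' t = Some j \<longleftrightarrow>
        x' = x \<and> s \<le> t \<and> t < s + real (proc_time j)"
      using S_job[OF i] by (intro exI[of _ "off i + y"] exI[of _ s]) auto
  qed
  ultimately show ?thesis
    unfolding feasible_def preemptive_feasible_def by simp
qed

section \<open>Opening times\<close>

lemma finite_released [simp]: "finite J \<Longrightarrow> finite (released J t)"
  by (simp add: released_def)

lemma min_machines_empty [simp]: "min_machines v {} = 0"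
proof -
  have "feasible v {} 0 (\<lambda>_ _. None)"
    by (simp add: feasible_def preemptive_feasible_def uninterrupted_def)
  then show ?thesis
    unfolding min_machines_def schedulable_def by (intro Least_eq_0) blast
qed

lemma schedulable_min_machines: "schedulable v J m \<Longrightarrow> schedulable v J (min_machines v J)"
  unfolding min_machines_def by (rule LeastI)

lemma m_at_le: "schedulable v J m \<Longrightarrow> m_at v J t \<le> m"
  unfolding m_at_def min_machines_def
  by (rule Least_le, erule schedulable_subset) (auto simp: released_def)

lemma released_cong:
  assumes "released J t = released J' t" "s \<le> t"
  shows "released J s = released J' s"
proof -
  have "released K s = {j \<in> released K t. real (release j) \<le> s}" for K
    using assms(2) by (auto simp: released_def)
  then show ?thesis using assms(1) by simp
qed

lemma m_at_cong:
  "\<lbrakk>released J t = released J' t; s \<le> t\<rbrakk> \<Longrightarrow> m_at v J s = m_at v J' s"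
  unfolding m_at_def using released_cong by metis

text \<open>A \<open>LEAST\<close> over the reals need not be attained. Here it is:
  \<open>m_at\<close> depends only on the set of released jobs, so a time at which it exceeds
  \<open>c\<close> can be moved back to the last release date before it, and there are finitely many
  release dates.\<close>

lemma m_at_first_exceeding:
  assumes "finite J" "m_at v J t > c"
  obtains s where "(LEAST t. m_at v J t > c) = s" "m_at v J s > c" "\<And>u. u < s \<Longrightarrow> m_at v J u \<le> c"
proof -
  define R where "R = {u \<in> (\<lambda>j. real (release j)) ` J. m_at v J u > c}"
  have fin: "finite R" using assms(1) by (simp add: R_def)
  have below: "\<exists>r\<in>R. r \<le> u" if u: "m_at v J u > c" for u
  proof -
    let ?X = "(\<lambda>j. real (release j)) ` released J u"
    \<comment> \<open>With no job released, \<open>m_at\<close> is 0 and cannot exceed a natural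
      number.\<close>
    have ne: "?X \<noteq> {}" using u by (auto simp: m_at_def)
    have finX: "finite ?X" using assms(1) by simp
    have max_in: "Max ?X \<in> ?X" using Max_in[OF finX ne] .
    have "released J (Max ?X) = released J u"
    proof
      show "released J (Max ?X) \<subseteq> released J u"
        using max_in by (auto simp: released_def)
      show "released J u \<subseteq> released J (Max ?X)"
        using Max_ge[OF finX] by (auto simp: released_def)
    qed
    then have "Max ?X \<in> R"
      using u max_in by (auto simp: R_def m_at_def released_def)
    moreover have "Max ?X \<le> u"
      using max_in by (auto simp: released_def)
    ultimately show ?thesis by blast
  qed
  have ne: "R \<noteq> {}" using below assms(2) by blast
  have least: "Min R \<le> u" if "m_at v J u > c" for u
    using below[OF that] Min_le[OF fin] by force
  have Min_ex: "m_at v J (Min R) > c"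
    using Min_in[OF fin ne] by (simp add: R_def)
  show thesis
  proof (rule that)
    show "(LEAST t. m_at v J t > c) = Min R"
      by (rule Least_equality) (use Min_ex least in auto)
    show "m_at v J u \<le> c" if "u < Min R" for u
      using least[of u] that by linarith
  qed (rule Min_ex)
qed

section \<open>The recursion for the opening times\<close>

lemma double_time_SucD:
  assumes "finite J" "double_time v J (Suc i) = Some s'"
  obtains s where "double_time v J i = Some s" "m_at v J s' > 2 * m_at v J s"
    "\<And>t. t < s' \<Longrightarrow> m_at v J t \<le> 2 * m_at v J s"
proof -
  obtain s where s: "double_time v J i = Some s"
    using assms(2) by (cases "double_time v J i") auto
  then obtain t where t: "m_at v J t > 2 * m_at v J s"
    using assms(2) by (auto split: if_splits)
  obtain u where u: "(LEAST t. m_at v J t > 2 * m_at v J s) = u" "m_at v J u > 2 * m_at v J s"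
    "\<And>t. t < u \<Longrightarrow> m_at v J t \<le> 2 * m_at v J s"
    using m_at_first_exceeding[OF assms(1) t] by metis
  have "s' = u" using assms(2) s u(1) t by (auto split: if_splits)
  then show thesis using that s u by blast
qed

lemma double_time_SucI:
  assumes "double_time v J i = Some s" "m_at v J s' > 2 * m_at v J s"
    "\<And>t. t < s' \<Longrightarrow> m_at v J t \<le> 2 * m_at v J s"
  shows "double_time v J (Suc i) = Some s'"
proof -
  have "(LEAST t. m_at v J t > 2 * m_at v J s) = s'"
    by (rule Least_equality) (use assms(2,3) in \<open>auto simp: not_less[symmetric]\<close>)
  then show ?thesis using assms(1,2) by auto
qed

text \<open>
  The function \<open>m_at v J\<close> need not be monotone: if the released jobs are not schedulable,
  \<open>m_at\<close> takes an unspecified value.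
\<close>

lemma m_at_le_m_at_double_time:
  assumes "finite J" "double_time v J i = Some s" "t \<le> s"
  shows "m_at v J t \<le> m_at v J s"
proof (cases "t = s")
  case False
  then have "t < s" using assms(3) by simp
  \<comment> \<open>Before the first opening time no job is released and \<open>m_at\<close> is 0.
    Before a later one, \<open>m_at\<close> respects the bound set by the preceding opening time,
    which it exceeds at \<open>s\<close>.\<close>
  show ?thesis
  proof (cases i)
    case 0
    then have "s = Min ((\<lambda>j. real (release j)) ` J)"
      using assms(2) by (auto split: if_splits)
    then have "s \<le> real (release j)" if "j \<in> J" for j
      using assms(1) that by simp
    then have "released J t = {}"
      using \<open>t < s\<close> by (fastforce simp: released_def)
    then show ?thesis by (simp add: m_at_def)
  next
    case (Suc k)
    then obtain u where "m_at v J s > 2 * m_at v J u" "m_at v J t \<le> 2 * m_at v J u"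
      using double_time_SucD[OF assms(1), of v k s] assms(2) \<open>t < s\<close> by metis
    then show ?thesis by simp
  qed
qed simp

text \<open>The \<open>LEAST\<close> in \<open>double_time\<close> ranges over all times, not only
  those after \<open>s\<close>. But up to \<open>s\<close> the value of \<open>m_at\<close> is at
  most \<open>m_at v J s\<close>, hence not above twice that.\<close>

lemma double_time_less_Suc:
  assumes "finite J" "double_time v J i = Some s" "double_time v J (Suc i) = Some s'"
  shows "s < s'"
proof (rule ccontr)
  assume "\<not> s < s'"
  then have "m_at v J s' \<le> m_at v J s"
    using m_at_le_m_at_double_time[OF assms(1,2)] by simp
  moreover have "m_at v J s' > 2 * m_at v J s"
    using double_time_SucD[OF assms(1,3)] assms(2) by (metis option.inject)
  ultimately show False by simp
qed

section \<open>Phases as a finite initial segment of the indices\<close>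

lemma double_time_down:
  assumes "finite J" "double_time v J i = Some s" "k \<le> i"
  shows "\<exists>u\<le>s. double_time v J k = Some u"
  using assms(3,2)
proof (induction i arbitrary: s rule: dec_induct)
  case (step i)
  obtain r where r: "double_time v J i = Some r"
    using double_time_SucD[OF assms(1) step.prems] by blast
  then have "r < s"
    using double_time_less_Suc[OF assms(1)] step.prems by blast
  with step.IH[OF r] show ?case by force
qed auto

text \<open>Each opening time strictly increases \<open>m_at\<close>. The bound is only linear in
  the index because the first value may be 0, so that doubling alone gives no growth.\<close>

lemma double_time_index_le:
  assumes "finite J" "double_time v J i = Some s"
  shows "i \<le> m_at v J s"
  using assms(2)
proof (induction i arbitrary: s)
  case (Suc i)
  then obtain u where "double_time v J i = Some u" "m_at v J s > 2 * m_at v J u"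
    using double_time_SucD[OF assms(1)] by metis
  with Suc.IH[of u] show ?case by linarith
qed simp

text \<open>The online property concerns every finite \<open>J\<close>, schedulable or not, so no
  number \<open>m\<close> of machines is at hand as a bound. Instead, \<open>m_at\<close> takes only
  values of \<open>min_machines\<close> on the finitely many subsets of \<open>J\<close>.\<close>

lemma finite_phases:
  assumes "finite J"
  shows "finite {i. \<exists>s. double_time v J i = Some s}"
proof (rule finite_subset)
  show "{i. \<exists>s. double_time v J i = Some s} \<subseteq> {..Max (min_machines v ` Pow J)}"
  proof clarify
    fix i s assume "double_time v J i = Some s"
    then have "i \<le> m_at v J s"
      by (rule double_time_index_le[OF assms])
    also have "\<dots> \<le> Max (min_machines v ` Pow J)"
      unfolding m_at_def by (rule Max_ge) (use assms in \<open>auto simp: released_def\<close>)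
    finally show "i \<le> Max (min_machines v ` Pow J)" .
  qed
qed simp

lemma finite_down_closed_nat:
  fixes X :: "nat set"
  assumes "finite X" "\<And>i k. \<lbrakk>i \<in> X; k \<le> i\<rbrakk> \<Longrightarrow> k \<in> X"
  obtains n where "X = {..<n}"
proof (cases "X = {}")
  case False
  then have "Max X \<in> X"
    using assms(1) by simp
  then have "X = {..<Suc (Max X)}"
    unfolding lessThan_Suc_atMost using assms(2)[of "Max X"] Max_ge[OF assms(1)] by blast
  then show thesis by (rule that)
qed (use that[of 0] in simp)

lemma phasesE:
  assumes "finite J"
  obtains N where "{i. \<exists>s. double_time v J i = Some s} = {..<N}"
  by (rule finite_down_closed_nat[OF finite_phases[OF assms, of v]])
    (use double_time_down[OF assms] in blast)

text \<open>Opening times increase with the index, so the phases begun by time \<open>t\<close> are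
  the first \<open>n\<close>. This turns \<open>double_opened\<close> at \<open>t\<close> into the
  offset of phase \<open>n\<close>.\<close>

lemma active_phasesE:
  assumes "finite J"
  obtains n where "{i. \<exists>s. double_time v J i = Some s \<and> s \<le> t} = {..<n}"
proof (rule finite_down_closed_nat)
  show "finite {i. \<exists>s. double_time v J i = Some s \<and> s \<le> t}"
    by (rule finite_subset[OF _ finite_phases[OF assms, of v]]) blast
  show "k \<in> {i. \<exists>s. double_time v J i = Some s \<and> s \<le> t}"
    if "i \<in> {i. \<exists>s. double_time v J i = Some s \<and> s \<le> t}" "k \<le> i" for i k
    using double_time_down[OF assms _ that(2)] that(1) by fastforce
qed

text \<open>An opening time \<open>s\<close> is determined by the first release date and the values
  of \<open>m_at\<close> up to \<open>s\<close>, all of which can be read off the jobs released up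
  to \<open>t\<close>.\<close>

lemma double_time_cong:
  assumes fin: "finite J" "finite J'"
    and rel: "released J t = released J' t"
    and "double_time v J i = Some s" "s \<le> t"
  shows "double_time v J' i = Some s"
  using assms(4,5)
proof (induction i arbitrary: s)
  case 0
  then have "J \<noteq> {}" and s: "s = Min ((\<lambda>j. real (release j)) ` J)"
    by (auto split: if_splits)
  then have "s \<in> (\<lambda>j. real (release j)) ` J"
    using fin(1) by (simp only: s) (rule Min_in; simp)
  then obtain j where j: "j \<in> J" "s = real (release j)" by blast
  have "j \<in> J'"
    using j rel 0(2) by (auto simp: released_def)
  moreover have "s \<le> real (release k)" if "k \<in> J'" for k
  proof (rule ccontr)
    \<comment> \<open>A job of \<open>J'\<close> released before \<open>s\<close> would be released
      by time \<open>t\<close>, hence belong to \<open>J\<close> as well, against the minimality of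
      \<open>s\<close>.\<close>
    assume "\<not> s \<le> real (release k)"
    then have "k \<in> released J t" "real (release k) < s"
      unfolding rel using that 0(2) by (auto simp: released_def)
    then have "k \<in> J"
      by (simp add: released_def)
    then have "s \<le> real (release k)"
      unfolding s using fin(1) by simp
    then show False using \<open>real (release k) < s\<close> by simp
  qed
  ultimately have "Min ((\<lambda>j. real (release j)) ` J') = s"
    using fin(2) j by (intro Min_eqI) auto
  then show ?case using \<open>j \<in> J'\<close> by auto
next
  case (Suc i)
  obtain u where u: "double_time v J i = Some u" "m_at v J s > 2 * m_at v J u"
    "\<And>t. t < s \<Longrightarrow> m_at v J t \<le> 2 * m_at v J u"
    using double_time_SucD[OF fin(1) Suc.prems(1)] by metis
  \<comment> \<open>This places \<open>u\<close> within the common past too, both for the induction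
    hypothesis and for comparing \<open>m_at\<close> at \<open>u\<close>.\<close>
  have "u < s"
    using double_time_less_Suc[OF fin(1) u(1) Suc.prems(1)] .
  then have m_eq: "m_at v J r = m_at v J' r" if "r \<le> s" for r
    using m_at_cong[OF rel] that Suc.prems(2) by force
  show ?case
  proof (rule double_time_SucI)
    show "double_time v J' i = Some u"
      using Suc.IH[OF u(1)] \<open>u < s\<close> Suc.prems(2) by simp
    show "m_at v J' s > 2 * m_at v J' u"
      using u(2) m_eq \<open>u < s\<close> by simp
    show "m_at v J' r \<le> 2 * m_at v J' u" if "r < s" for r
      using u(3)[OF that] m_eq[of r] m_eq[of u] that \<open>u < s\<close> by simp
  qed
qed

section \<open>Algorithm Double is an online algorithm\<close>

lemma phase_offset_mono: "i \<le> k \<Longrightarrow> phase_offset v \<rho> J i \<le> phase_offset v \<rho> J k"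
  unfolding phase_offset_def by (rule sum_mono2) auto

text \<open>Offsets increase only weakly, since a phase may open no machine. Still, every block
  before \<open>i\<close> ends at or below \<open>phase_offset v \<rho> J i\<close>, hence at or
  below \<open>x\<close>.\<close>

lemma machine_phase_eq:
  assumes "phase_offset v \<rho> J i \<le> x" "x < phase_offset v \<rho> J (Suc i)"
  shows "machine_phase v \<rho> J x = i"
  unfolding machine_phase_def
proof (rule Least_equality)
  fix k assume "x < phase_offset v \<rho> J (Suc k)"
  then have "\<not> Suc k \<le> i"
    using phase_offset_mono[of "Suc k" i v \<rho> J] assms(1) by auto
  then show "i \<le> k" by simp
qed (rule assms(2))

lemma machine_phaseE:
  assumes "x < phase_offset v \<rho> J n"
  obtains i where "i < n" "machine_phase v \<rho> J x = i"
    "phase_offset v \<rho> J i \<le> x" "x < phase_offset v \<rho> J (Suc i)"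
proof -
  have "\<exists>i<n. phase_offset v \<rho> J i \<le> x \<and> x < phase_offset v \<rho> J (Suc i)"
    using assms
  proof (induction n)
    case (Suc n)
    show ?case
    proof (cases "x < phase_offset v \<rho> J n")
      case True
      then show ?thesis using Suc.IH less_SucI by blast
    next
      case False
      then show ?thesis using Suc.prems by auto
    qed
  qed (simp add: phase_offset_def)
  then show thesis using that machine_phase_eq by blast
qed

lemma double_opened_eq:
  assumes "{i. \<exists>s. double_time v J i = Some s \<and> s \<le> t} = {..<n}"
  shows "double_opened v \<rho> J t = phase_offset v \<rho> J n"
  unfolding double_opened_def phase_offset_def assms ..

lemma mono_double_opened:
  assumes "finite J"
  shows "mono (double_opened v \<rho> J)"
proof
  fix s t :: real assume "s \<le> t"
  show "double_opened v \<rho> J s \<le> double_opened v \<rho> J t"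
    unfolding double_opened_def
  proof (rule sum_mono2)
    show "finite {i. \<exists>s. double_time v J i = Some s \<and> s \<le> t}"
      by (rule finite_subset[OF _ finite_phases[OF assms, of v]]) blast
  qed (use \<open>s \<le> t\<close> in auto)
qed

lemma finite_phase_jobs: "finite J \<Longrightarrow> finite (phase_jobs v J i)"
  by (simp add: phase_jobs_def)

text \<open>Membership in phase \<open>i\<close> refers to the next opening time, which may lie in
  the future of \<open>t\<close> and differ between \<open>J\<close> and \<open>J'\<close>. Only one
  inclusion is shown; exchanging \<open>J\<close> and \<open>J'\<close> gives the other.\<close>

lemma released_phase_jobs_subset:
  assumes fin: "finite J" "finite J'"
    and rel: "released J t = released J' t"
    and s: "double_time v J i = Some s" "s \<le> t"
  shows "released (phase_jobs v J i) t \<subseteq> released (phase_jobs v J' i) t"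
proof
  fix j assume "j \<in> released (phase_jobs v J i) t"
  then have j: "j \<in> J" "real (release j) \<le> t" "s \<le> real (release j)"
    and before: "\<And>s'. double_time v J (Suc i) = Some s' \<Longrightarrow> real (release j) < s'"
    using s(1) unfolding released_def phase_jobs_def by auto
  have "j \<in> J'"
    using j rel by (auto simp: released_def)
  moreover have "double_time v J' i = Some s"
    by (rule double_time_cong[OF fin rel s])
  moreover have "real (release j) < s'" if "double_time v J' (Suc i) = Some s'" for s'
  \<comment> \<open>An opening time up to \<open>t\<close> is shared by both instances; a later one
    lies after the release of \<open>j\<close> anyway.\<close>
  proof (cases "s' \<le> t")
    case True
    then show ?thesis
      using before double_time_cong[OF fin(2,1) rel[symmetric] that] by blast
  qed (use j in simp)
  ultimately show "j \<in> released (phase_jobs v J' i) t"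
    using j unfolding released_def phase_jobs_def by simp
qed

text \<open>At time \<open>t\<close> the two instances agree on the phases begun, their guesses,
  their machine blocks and the released jobs of each phase. The subroutine, being online, then acts
  identically in each block.\<close>

lemma online_double:
  assumes A: "semi_online_algorithm A"
  shows "online_algorithm (double v \<rho> A)"
  unfolding online_algorithm_def
proof (intro conjI allI impI)
  fix J J' :: "job set" and t :: real
  assume "finite J \<and> finite J' \<and> released J t = released J' t"
  then have fin: "finite J" "finite J'" and rel: "released J t = released J' t" by auto
  obtain n where n: "{i. \<exists>s. double_time v J i = Some s \<and> s \<le> t} = {..<n}"
    using active_phasesE[OF fin(1)] .
  have n': "{i. \<exists>s. double_time v J' i = Some s \<and> s \<le> t} = {..<n}"
    unfolding n[symmetric]
    using double_time_cong[OF fin rel, of v] double_time_cong[OF fin(2,1) rel[symmetric], of v]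
    by blast
  have active: "\<exists>s. double_time v J i = Some s \<and> double_time v J' i = Some s \<and> s \<le> t"
    if "i < n" for i
    using n that double_time_cong[OF fin rel, of v] by blast
  have guess: "phase_guess v J i = phase_guess v J' i" if "i < n" for i
    using active[OF that] m_at_cong[OF rel] by (auto simp: phase_guess_def)
  \<comment> \<open>The case \<open>i = n\<close> is included: it gives the number of open machines
    and the end of the last block.\<close>
  have offset: "phase_offset v \<rho> J i = phase_offset v \<rho> J' i" if "i \<le> n" for i
    unfolding phase_offset_def phase_machines_def
    by (rule sum.cong) (use guess that in auto)
  have opened: "double_opened v \<rho> J t = double_opened v \<rho> J' t"
    using double_opened_eq[OF n] double_opened_eq[OF n'] offset by simp
  then show "opened (double v \<rho> A J) t = opened (double v \<rho> A J') t"
    by (simp add: double_def)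
  fix x
  have "double_sched v \<rho> A J x t = double_sched v \<rho> A J' x t"
  proof (cases "x < double_opened v \<rho> J t")
    case True
    then have "x < phase_offset v \<rho> J n"
      using double_opened_eq[OF n] by simp
    then obtain i where i: "i < n" "machine_phase v \<rho> J x = i"
      "phase_offset v \<rho> J i \<le> x" "x < phase_offset v \<rho> J (Suc i)"
      by (rule machine_phaseE)
    then have i': "machine_phase v \<rho> J' x = i"
      using offset by (intro machine_phase_eq) auto
    have "released (phase_jobs v J i) t = released (phase_jobs v J' i) t"
      using released_phase_jobs_subset[OF fin rel]
        released_phase_jobs_subset[OF fin(2,1) rel[symmetric]] active[OF i(1)] by blast
    \<comment> \<open>The subroutine is online for every given value \<open>m\<close>, whether or
      not the jobs can be scheduled on \<open>m\<close> machines.\<close>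
    then have "sched (A m (phase_jobs v J i)) y t = sched (A m (phase_jobs v J' i)) y t" for m y
      using A[unfolded semi_online_algorithm_def online_algorithm_def, THEN spec[of _ m],
          THEN conjunct1, THEN spec, THEN spec, THEN spec, THEN mp, THEN conjunct2, THEN spec]
        finite_phase_jobs[OF fin(1)] finite_phase_jobs[OF fin(2)] by simp
    then show ?thesis
      using i i' opened guess[OF i(1)] offset[of i] by (simp add: double_sched_def)
  next
    case False
    then show ?thesis using opened by (simp add: double_sched_def)
  qed
  then show "sched (double v \<rho> A J) x t = sched (double v \<rho> A J') x t"
    by (simp add: double_def)
next
  fix J :: "job set" assume "finite J"
  then show "mono (opened (double v \<rho> A J))"
    by (simp add: double_def mono_double_opened)
next
  fix J x t j assume "sched (double v \<rho> A J) x t = Some j"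
  then show "x < opened (double v \<rho> A J) t"
    by (auto simp: double_def double_sched_def split: if_splits)
qed

section \<open>Competitiveness\<close>

lemma sum_phase_guess_le:
  assumes "finite J" "schedulable v J m"
    and "{i. \<exists>s. double_time v J i = Some s} = {..<N}"
  shows "(\<Sum>i<N. phase_guess v J i) \<le> 4 * m"
proof (cases N)
  case (Suc k)
  have bound: "(\<Sum>i<Suc k. phase_guess v J i) \<le> 4 * m_at v J s"
    if "double_time v J k = Some s" for k s
    using that
  proof (induction k arbitrary: s)
    case 0
    then show ?case by (simp add: phase_guess_def del: double_time.simps)
  next
    case (Suc k)
    obtain u where u: "double_time v J k = Some u" "m_at v J s > 2 * m_at v J u"
      using double_time_SucD[OF assms(1) Suc.prems] by metis
    have "phase_guess v J (Suc k) = 2 * m_at v J s"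
      using Suc.prems by (simp add: phase_guess_def del: double_time.simps)
    \<comment> \<open>The guesses so far sum to at most \<open>4 * m_at v J u\<close>, which is less
      than \<open>2 * m_at v J s\<close>, the new guess. Adding that guess gives at most
      \<open>4 * m_at v J s\<close>.\<close>
    then show ?case
      using Suc.IH[OF u(1)] u(2) by simp
  qed
  have "k \<in> {i. \<exists>s. double_time v J i = Some s}"
    unfolding assms(3) Suc by simp
  then obtain s where "double_time v J k = Some s"
    by blast
  then have "(\<Sum>i<N. phase_guess v J i) \<le> 4 * m_at v J s"
    unfolding Suc by (rule bound)
  then show ?thesis
    using m_at_le[OF assms(2), of s] by linarith
qed simp

text \<open>All jobs of the phase are released by its last release date \<open>t\<close>, so the
  optimum for the jobs released up to \<open>t\<close> suffices, and it is at most the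
  guess.\<close>

lemma schedulable_phase_jobs:
  assumes "finite J" "schedulable v J m"
  shows "schedulable v (phase_jobs v J i) (phase_guess v J i)"
proof (cases "phase_jobs v J i = {}")
  \<comment> \<open>This includes indices without an opening time, where the guess is 0.\<close>
  case True
  then show ?thesis
    by (auto simp: schedulable_def feasible_def preemptive_feasible_def uninterrupted_def)
next
  case False
  define t where "t = Max ((\<lambda>j. real (release j)) ` phase_jobs v J i)"
  have "t \<in> (\<lambda>j. real (release j)) ` phase_jobs v J i"
    unfolding t_def using False finite_phase_jobs[OF assms(1)] by (intro Max_in) auto
  then obtain j where j: "j \<in> phase_jobs v J i" "t = real (release j)" by blast
  have "real (release k) \<le> t" if "k \<in> phase_jobs v J i" for k
    unfolding t_def using that finite_phase_jobs[OF assms(1)] by simp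
  then have sub: "phase_jobs v J i \<subseteq> released J t"
    by (auto simp: released_def phase_jobs_def)
  obtain s where s: "double_time v J i = Some s"
    using j unfolding phase_jobs_def by blast
  have "m_at v J t \<le> 2 * m_at v J s"
  proof (rule ccontr)
    assume "\<not> m_at v J t \<le> 2 * m_at v J s"
    then have t: "m_at v J t > 2 * m_at v J s" by simp
    obtain u where u: "m_at v J u > 2 * m_at v J s" "\<And>r. r < u \<Longrightarrow> m_at v J r \<le> 2 * m_at v J s"
      using m_at_first_exceeding[OF assms(1) t] by metis
    \<comment> \<open>The first violation \<open>u\<close> of the bound would open the next phase at
      or before \<open>t\<close>, although a job released at \<open>t\<close> belongs to phase
      \<open>i\<close>.\<close>
    have "double_time v J (Suc i) = Some u"
      by (rule double_time_SucI[OF s u])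
    then have "t < u"
      using j unfolding phase_jobs_def by blast
    then show False using u(2) t by fastforce
  qed
  moreover have "schedulable v (released J t) m"
    by (rule schedulable_subset[OF assms(2)]) (auto simp: released_def)
  then have "schedulable v (released J t) (m_at v J t)"
    unfolding m_at_def by (rule schedulable_min_machines)
  ultimately show ?thesis
    using s sub by (simp add: phase_guess_def schedulable_subset)
qed

text \<open>If \<open>a < b\<close>, a job of phase \<open>a\<close> is released before opening time
  \<open>a + 1\<close>, which is no later than opening time \<open>b\<close>, while a job of phase
  \<open>b\<close> is released from then on.\<close>

lemma phase_jobs_unique:
  assumes "finite J" "j \<in> phase_jobs v J i" "j \<in> phase_jobs v J k"
  shows "i = k"
proof -
  have "\<not> a < b" if ab: "j \<in> phase_jobs v J a" "j \<in> phase_jobs v J b" for a b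
  proof
    assume "a < b"
    obtain s where s: "double_time v J b = Some s" "s \<le> real (release j)"
      using ab(2) unfolding phase_jobs_def by blast
    obtain u where "u \<le> s" "double_time v J (Suc a) = Some u"
      using double_time_down[OF assms(1) s(1), of "Suc a"] \<open>a < b\<close> by auto
    then have "real (release j) < u"
      using ab(1) unfolding phase_jobs_def by blast
    then show False using \<open>u \<le> s\<close> s(2) by simp
  qed
  then show ?thesis using assms(2,3) nat_neq_iff by metis
qed

text \<open>A job belongs to the phase of the last opening time up to its release. One exists, since
  the first opening time is the least release date.\<close>

lemma UN_phase_jobs:
  assumes "finite J" "{i. \<exists>s. double_time v J i = Some s} = {..<N}"
  shows "(\<Union>i<N. phase_jobs v J i) = J"
proof
  show "(\<Union>i<N. phase_jobs v J i) \<subseteq> J"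
    by (auto simp: phase_jobs_def)
  show "J \<subseteq> (\<Union>i<N. phase_jobs v J i)"
  proof
    fix j assume j: "j \<in> J"
    let ?t = "real (release j)"
    obtain n where n: "{i. \<exists>s. double_time v J i = Some s \<and> s \<le> ?t} = {..<n}"
      using active_phasesE[OF assms(1)] .
    have "Min ((\<lambda>j. real (release j)) ` J) \<le> ?t"
      using assms(1) j by (intro Min_le) auto
    then have "0 \<in> {..<n}"
      unfolding n[symmetric] using j by auto
    then obtain k where k: "n = Suc k"
      by (cases n) auto
    have "k \<in> {i. \<exists>s. double_time v J i = Some s \<and> s \<le> ?t}"
      unfolding n k by simp
    then obtain s where s: "double_time v J k = Some s" "s \<le> ?t"
      by blast
    have "Suc k \<notin> {i. \<exists>s. double_time v J i = Some s \<and> s \<le> ?t}"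
      unfolding n k by simp
    then have "?t < s'" if "double_time v J (Suc k) = Some s'" for s'
      using that by (force simp del: double_time.simps)
    then have "j \<in> phase_jobs v J k"
      using j s unfolding phase_jobs_def by blast
    moreover have "k < N"
      using assms(2) s(1) by blast
    ultimately show "j \<in> (\<Union>i<N. phase_jobs v J i)" by blast
  qed
qed

text \<open>This is the description of the schedule that \<open>feasible_UN\<close> asks for. Its
  content is that idling the machines not yet open discards nothing the subroutine does.\<close>

lemma double_sched_iff:
  assumes fin: "finite J"
    and N: "{i. \<exists>s. double_time v J i = Some s} = {..<N}"
    and feas: "\<And>i. feasible v (phase_jobs v J i) (phase_machines v \<rho> J i)
        (sched (A (phase_guess v J i) (phase_jobs v J i)))"
  shows "double_sched v \<rho> A J x t = Some j \<longleftrightarrow>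
    (\<exists>i<N. \<exists>y. x = phase_offset v \<rho> J i + y \<and>
      sched (A (phase_guess v J i) (phase_jobs v J i)) y t = Some j)"
proof -
  obtain n where n: "{i. \<exists>s. double_time v J i = Some s \<and> s \<le> t} = {..<n}"
    using active_phasesE[OF fin] .
  show ?thesis
  proof
    assume L: "double_sched v \<rho> A J x t = Some j"
    then have "x < phase_offset v \<rho> J n"
      using double_opened_eq[OF n, of \<rho>] by (auto simp: double_sched_def split: if_splits)
    then obtain i where i: "i < n" "machine_phase v \<rho> J x = i" "phase_offset v \<rho> J i \<le> x"
      by (rule machine_phaseE)
    have "i < N" using i(1) n N by blast
    moreover have
      "sched (A (phase_guess v J i) (phase_jobs v J i)) (x - phase_offset v \<rho> J i) t = Some j"
      using L i(2) by (auto simp: double_sched_def split: if_splits)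
    ultimately show "\<exists>i<N. \<exists>y. x = phase_offset v \<rho> J i + y \<and>
      sched (A (phase_guess v J i) (phase_jobs v J i)) y t = Some j"
      using i(3) by (intro exI[of _ i] conjI exI[of _ "x - phase_offset v \<rho> J i"]) auto
  next
    assume "\<exists>i<N. \<exists>y. x = phase_offset v \<rho> J i + y \<and>
      sched (A (phase_guess v J i) (phase_jobs v J i)) y t = Some j"
    then obtain i y where iy: "i < N" "x = phase_offset v \<rho> J i + y"
      "sched (A (phase_guess v J i) (phase_jobs v J i)) y t = Some j" by blast
    have y: "y < phase_machines v \<rho> J i" "j \<in> phase_jobs v J i" "real (release j) \<le> t"
      using feasibleD(1-3)[OF feas iy(3)] .
    \<comment> \<open>A job of phase \<open>i\<close> runs only after its release, hence not before
      the opening time of that phase.\<close>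
    then have "i \<in> {i. \<exists>s. double_time v J i = Some s \<and> s \<le> t}"
      unfolding phase_jobs_def by fastforce
    then have "Suc i \<le> n"
      unfolding n by simp
    have x: "x < phase_offset v \<rho> J (Suc i)"
      using iy(2) y(1) by (simp add: phase_offset_def)
    then have "x < double_opened v \<rho> J t"
      using phase_offset_mono[OF \<open>Suc i \<le> n\<close>, of v \<rho> J] double_opened_eq[OF n, of \<rho>] by simp
    moreover have "machine_phase v \<rho> J x = i"
      by (rule machine_phase_eq) (use iy(2) x in auto)
    ultimately show "double_sched v \<rho> A J x t = Some j"
      using iy(2,3) by (simp add: double_sched_def)
  qed
qed

text \<open>The total \<open>phase_offset v \<rho> J N\<close> over all phases serves as the number
  of machines: it bounds those open at any time and carries the combined schedule.\<close>

lemma double_solves_within: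
  assumes "\<rho> \<ge> 0" "competitive_semi_online v \<rho> A" "finite J" "schedulable v J m"
  shows "solves_within v J (4 * \<rho> * real m) (double v \<rho> A J)"
proof -
  obtain N where N: "{i. \<exists>s. double_time v J i = Some s} = {..<N}"
    using phasesE[OF assms(3)] .
  have feas: "feasible v (phase_jobs v J i) (phase_machines v \<rho> J i)
      (sched (A (phase_guess v J i) (phase_jobs v J i)))" for i
  proof -
    have "solves_within v (phase_jobs v J i) (\<rho> * real (phase_guess v J i))
        (A (phase_guess v J i) (phase_jobs v J i))"
      using assms(2) schedulable_phase_jobs[OF assms(3,4)] finite_phase_jobs[OF assms(3)]
      unfolding competitive_semi_online_def by blast
    then obtain M where M: "real M \<le> \<rho> * real (phase_guess v J i)"
      "feasible v (phase_jobs v J i) M (sched (A (phase_guess v J i) (phase_jobs v J i)))"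
      unfolding solves_within_def by blast
    \<comment> \<open>Rounding down loses nothing, because \<open>M\<close> is an integer.\<close>
    have "M \<le> phase_machines v \<rho> J i"
      using M(1) unfolding phase_machines_def by (simp add: le_nat_floor)
    with M(2) show ?thesis by (rule feasible_mono_machines)
  qed
  have "feasible v (\<Union>i<N. phase_jobs v J i) (\<Sum>k<N. phase_machines v \<rho> J k) (double_sched v \<rho> A J)"
    by (rule feasible_UN[where T = "\<lambda>i. sched (A (phase_guess v J i) (phase_jobs v J i))"])
      (auto simp: feas double_sched_iff[where A = A, OF assms(3) N feas] phase_offset_def
        intro: phase_jobs_unique[OF assms(3)])
  then have "feasible v J (phase_offset v \<rho> J N) (double_sched v \<rho> A J)"
    unfolding UN_phase_jobs[OF assms(3) N] phase_offset_def .
  moreover have "double_opened v \<rho> J t \<le> phase_offset v \<rho> J N" for t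
    unfolding double_opened_def phase_offset_def N[symmetric]
    by (rule sum_mono2) (use finite_phases[OF assms(3)] in auto)
  moreover have "real (phase_offset v \<rho> J N) \<le> 4 * \<rho> * real m"
  proof -
    have "real (phase_offset v \<rho> J N) \<le> (\<Sum>i<N. \<rho> * real (phase_guess v J i))"
      unfolding phase_offset_def of_nat_sum phase_machines_def
      by (rule sum_mono) (use assms(1) in simp)
    also have "\<dots> = \<rho> * real (\<Sum>i<N. phase_guess v J i)"
      by (simp add: sum_distrib_left)
    also have "\<dots> \<le> \<rho> * real (4 * m)"
      using sum_phase_guess_le[OF assms(3,4) N] assms(1)
      by (intro mult_left_mono of_nat_mono) auto
    finally show ?thesis by simp
  qed
  ultimately show ?thesis
    unfolding solves_within_def double_def by auto
qed

theorem theorem2: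
  fixes v :: variant and \<rho> :: real and A :: "nat \<Rightarrow> algorithm"
  assumes "\<rho> \<ge> 1"
    and "competitive_semi_online v \<rho> A"
  shows "competitive_online v (4 * \<rho>) (double v \<rho> A)"
  unfolding competitive_online_def
  using online_double double_solves_within[OF _ assms(2)] assms
  by (auto simp: competitive_semi_online_def)

end
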